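(* Let $g$ be a positive integer and $p$ a prime with $p\geq 2g+1$. Then the vectors $I^{m}(z)\in\mathbb F_p[z]^{2g+1}$, $m=0,\dots,g-1$ (polynomial solutions over $\mathbb F_p$ of the KZ equations, defined in the context), are linearly independent over the ring $\mathbb F_p[z^p]$; that is, if $\sum_{m=0}^{g-1} c_m(z)I^m(z)=0$ for some $c_m(z)\in\mathbb F_p[z^p]$, then $c_m(z)=0$ for all $m$.
   Context: Notation: $z=(z_1,\dots,z_{2g+1})$, $\mathbb F_p[z]=\mathbb F_p[z_1,\dots,z_{2g+1}]$, and $\mathbb F_p[z^p]=\mathbb F_p[z_1^p,\dots,z_{2g+1}^p]$. Master polynomial: $\Phi_p(t,z)=\prod_{a=1}^{2g+1}(t-z_a)^{(p-1)/2}\in\mathbb F_p[t,z]$. Let $P(t,z)=(P_1(t,z),\dots,P_{2g+1}(t,z))$ with $P_j(t,z)=\frac{1}{t-z_j}\Phi_p(t,z)$, a polynomial. Write $P(t,z)=\sum_{i=0}^{(p-1)/2+gp-g-1}P^i(z)t^i$ with $P^i(z)\in\mathbb F_p[z]^{2g+1}$. For $m=0,\dots,g-1$ set $I^m(z):=P^{(g-m)p-1}(z)$. *)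

theory Defs
  imports
    "HOL-Library.Poly_Mapping"
    "HOL-Computational_Algebra.Polynomial"
    "Berlekamp_Zassenhaus.Finite_Field"
begin

text \<open>
  The field with \<open>p\<close> elements is \<^typ>\<open>'p mod_ring\<close>, where \<open>p = CARD('p)\<close> and the class
  \<^class>\<open>prime_card\<close> says that \<open>p\<close> is prime.  A multivariate polynomial maps each monomial,
  given by its finitely supported exponent vector \<^typ>\<open>nat \<Rightarrow>\<^sub>0 nat\<close>, to its coefficient.
  The type provides the variables \<open>z\<^sub>i\<close> for all natural numbers \<open>i\<close>; the polynomial
  rings in \<open>z\<^sub>1, \<dots>, z\<^sub>2\<^sub>g\<^sub>+\<^sub>1\<close> are carved out as subalgebras.
\<close>

type_synonym 'p fp_poly = "(nat \<Rightarrow>\<^sub>0 nat) \<Rightarrow>\<^sub>0 'p mod_ring"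

definition const :: "'p::prime_card mod_ring \<Rightarrow> 'p fp_poly"
  where "const a = Poly_Mapping.single 0 a"

definition z :: "nat \<Rightarrow> 'p::prime_card fp_poly"
  where "z i = Poly_Mapping.single (Poly_Mapping.single i 1) 1"

inductive_set subalgebra_gen :: "'p::prime_card fp_poly set \<Rightarrow> 'p fp_poly set"
  for S :: "'p fp_poly set"
where
  const: "const a \<in> subalgebra_gen S"
| gen: "x \<in> S \<Longrightarrow> x \<in> subalgebra_gen S"
| add: "x \<in> subalgebra_gen S \<Longrightarrow> y \<in> subalgebra_gen S \<Longrightarrow> x + y \<in> subalgebra_gen S"
| mult: "x \<in> subalgebra_gen S \<Longrightarrow> y \<in> subalgebra_gen S \<Longrightarrow> x * y \<in> subalgebra_gen S"

text \<open>\<open>\<bbbF>\<^sub>p[z]\<close> and \<open>\<bbbF>\<^sub>p[z\<^sup>p]\<close>\<close>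

definition Fp_z :: "nat \<Rightarrow> 'p::prime_card fp_poly set"
  where "Fp_z g = subalgebra_gen (z ` {1..2 * g + 1})"

definition Fp_zp :: "nat \<Rightarrow> 'p::prime_card fp_poly set"
  where "Fp_zp g = subalgebra_gen ((\<lambda>i. z i ^ CARD('p)) ` {1..2 * g + 1})"

text \<open>Polynomials in \<open>t\<close> and \<open>z\<close> are univariate polynomials in \<open>t\<close> with coefficients in \<open>z\<close>.\<close>

definition master_poly :: "nat \<Rightarrow> 'p::prime_card fp_poly poly"
  where "master_poly g = (\<Prod>a = 1..2 * g + 1. [:- z a, 1:] ^ ((CARD('p) - 1) div 2))"

text \<open>
  \<open>P\<^sub>j = \<Phi>\<^sub>p / (t - z\<^sub>j)\<close>; \<^term>\<open>synthetic_div q c\<close> is the quotient of \<open>q\<close> by \<open>t - c\<close>.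
  The division is exact and the quotient unique, see \<open>P_poly_unique\<close> below.
\<close>

definition P_poly :: "nat \<Rightarrow> nat \<Rightarrow> 'p::prime_card fp_poly poly"
  where "P_poly g j = synthetic_div (master_poly g) (z j)"

text \<open>The \<open>j\<close>-th coordinate, \<open>j \<in> {1..2g+1}\<close>, of \<open>P\<^sup>i(z)\<close>\<close>

definition P_coeff :: "nat \<Rightarrow> nat \<Rightarrow> nat \<Rightarrow> 'p::prime_card fp_poly"
  where "P_coeff g i j = coeff (P_poly g j) i"

definition I_sol :: "nat \<Rightarrow> nat \<Rightarrow> nat \<Rightarrow> 'p::prime_card fp_poly"
  where "I_sol g m j = P_coeff g ((g - m) * CARD('p) - 1) j"

lemma P_poly_unique:
  fixes Q :: "'p::prime_card fp_poly poly"
  assumes "CARD('p) \<ge> 3" and j: "j \<in> {1..2 * g + 1}"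
  shows "[:- z j, 1:] * Q = master_poly g \<longleftrightarrow> Q = P_poly g j"
proof -
  have "(CARD('p) - 1) div 2 > 0"
    using assms(1) by auto
  then have "[:- z j, 1:] dvd [:- z j, 1:] ^ ((CARD('p) - 1) div 2)"
    by (simp add: dvd_power)
  also have "\<dots> dvd (master_poly g :: 'p fp_poly poly)"
    unfolding master_poly_def using j by (intro dvd_prodI) auto
  finally have "poly (master_poly g :: 'p fp_poly poly) (z j) = 0"
    by (simp add: poly_eq_0_iff_dvd)
  then have "[:- z j, 1:] * P_poly g j = (master_poly g :: 'p fp_poly poly)"
    using synthetic_div_correct'[of "z j" "master_poly g :: 'p fp_poly poly"]
    by (simp add: P_poly_def)
  then show ?thesis
    by (metis mult_cancel_left one_neq_zero pCons_eq_0_iff)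
qed

lemma Fp_z_uminus: "- x \<in> Fp_z g" if "x \<in> Fp_z g"
proof -
  have "- x = const (- 1) * x"
    by (simp add: const_def single_uminus flip: single_one)
  then show ?thesis
    using that by (simp add: Fp_z_def subalgebra_gen.intros)
qed

lemma I_sol_in_Fp_z:
  assumes j: "j \<in> {1..2 * g + 1}"
  shows "I_sol g m j \<in> (Fp_z g :: 'p::prime_card fp_poly set)"
proof -
  let ?R = "Fp_z g :: 'p fp_poly set"
  define C where "C = {q :: 'p fp_poly poly. \<forall>i. coeff q i \<in> ?R}"
  have c: "const a \<in> ?R" for a
    by (simp add: Fp_z_def subalgebra_gen.const)
  have zero: "0 \<in> ?R" and one: "1 \<in> ?R"
    using c[of 0] c[of 1] by (simp_all add: const_def)
  have add: "x + y \<in> ?R" and mult: "x * y \<in> ?R" if "x \<in> ?R" "y \<in> ?R" for x y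
    using that by (simp_all add: Fp_z_def subalgebra_gen.intros)
  have z: "z a \<in> ?R" if "a \<in> {1..2 * g + 1}" for a
    using that by (simp add: Fp_z_def subalgebra_gen.gen)
  have sum: "sum f A \<in> ?R" if "\<And>a. a \<in> A \<Longrightarrow> f a \<in> ?R" for f and A :: "nat set"
    using that by (induction A rule: infinite_finite_induct) (auto intro: zero add)
  have multC: "p * q \<in> C" if "p \<in> C" "q \<in> C" for p q
    using that by (auto simp: C_def coeff_mult intro!: sum mult)
  have oneC: "1 \<in> C"
    by (auto simp: C_def zero one)
  have powC: "p ^ n \<in> C" if "p \<in> C" for p n
    using that by (induction n) (auto intro: oneC multC)
  have linC: "[:- z a, 1:] \<in> C" if "a \<in> {1..2 * g + 1}" for a
    using z[OF that] by (auto simp: C_def coeff_pCons zero one Fp_z_uminus split: nat.splits)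
  have prodC: "prod f A \<in> C" if "\<And>a. a \<in> A \<Longrightarrow> f a \<in> C" for f and A :: "nat set"
    using that by (induction A rule: infinite_finite_induct) (auto intro: oneC multC)
  have masterC: "master_poly g \<in> C"
    unfolding master_poly_def by (intro prodC powC linC)
  have divC: "poly q (z j) \<in> ?R \<and> synthetic_div q (z j) \<in> C" if "q \<in> C" for q
    using that
  proof (induction q)
    case 0
    then show ?case by (simp add: zero C_def)
  next
    case (pCons a q)
    have a: "a \<in> ?R" and q: "q \<in> C"
      using pCons.prems by (auto simp: C_def dest: spec[of _ 0] spec[of _ "Suc _"])
    have IH: "poly q (z j) \<in> ?R" "synthetic_div q (z j) \<in> C"
      using pCons.IH[OF q] by auto
    then show ?case
      using a z[OF j] by (auto simp: C_def coeff_pCons add mult split: nat.splits)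
  qed
  then show ?thesis
    using masterC by (auto simp: I_sol_def P_coeff_def P_poly_def C_def)
qed

end

theory Submission
  imports Defs
begin

text \<open>
  The first coordinates \<open>I\<^sup>m\<^sub>1\<close> are already independent.  Write \<open>p = 2q + 1\<close>.  As a coefficient
  of a product of powers \<open>(t - z\<^sub>a)\<^sup>n\<close> with \<open>n \<le> q < p\<close>, the polynomial \<open>I\<^sup>m\<^sub>1\<close> is nonzero, because
  the binomial coefficients involved are units modulo \<open>p\<close>; all its exponents are below \<open>p\<close>; and
  it is homogeneous of degree \<open>mp + q - g\<close>.  The monomials with exponents below \<open>p\<close> form a basis of
  \<open>\<bbbF>\<^sub>p[z]\<close> over \<open>\<bbbF>\<^sub>p[z\<^sup>p]\<close>, and the degrees are pairwise distinct, so the expansions of the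
  \<open>I\<^sup>m\<^sub>1\<close> in this basis have nonempty and pairwise disjoint supports.
\<close>

section \<open>Monomials and coefficients of sparse polynomials\<close>

abbreviation "lookup \<equiv> Poly_Mapping.lookup"
abbreviation "keys \<equiv> Poly_Mapping.keys"

text \<open>The convolution defining the coefficient at \<open>a + b\<close> collapses to one term.
  This also covers \<open>a\<close> or \<open>b\<close> outside the supports, where both sides
  vanish. It serves to separate an exponent vector divisible by p from one with entries below
  p.\<close>

lemma lookup_mult_unique_split:
  fixes f g :: "'a::monoid_add \<Rightarrow>\<^sub>0 'b::semiring_0"
  assumes "\<And>l r. l \<in> keys f \<Longrightarrow> r \<in> keys g \<Longrightarrow> l + r = a + b \<Longrightarrow> l = a \<and> r = b"
  shows "lookup (f * g) (a + b) = lookup f a * lookup g b"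
proof -
  have "lookup f l * (\<Sum>r. lookup g r when a + b = l + r) =
        (lookup f a * lookup g b when l = a)" for l
  proof (cases "l \<in> keys f")
    case True
    have "(lookup g r when a + b = l + r) = ((lookup g b when l = a) when r = b)" for r
    proof (cases "r \<in> keys g \<and> l + r = a + b")
      case split: True
      then have "l = a" and "r = b"
        using assms[OF True] by blast+
      then show ?thesis by simp
    next
      case False
      then consider "lookup g r = 0" | "a + b \<noteq> l + r"
        by (auto simp: in_keys_iff)
      then show ?thesis
        by cases (auto simp: when_def)
    qed
    then show ?thesis
      by (auto simp: when_def)
  qed (auto simp: when_def in_keys_iff)
  then show ?thesis
    by (simp add: lookup_mult)
qed

lemma lookup_sum_single:
  fixes h :: "'a \<Rightarrow> 'b::comm_monoid_add"
  assumes "finite A"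
  shows "lookup (\<Sum>a\<in>A. Poly_Mapping.single a (h a)) i = (if i \<in> A then h i else 0)"
  using assms by (simp add: lookup_sum lookup_single when_def)

lemma prod_single:
  fixes e :: "'i \<Rightarrow> 'a::comm_monoid_add" and x :: "'i \<Rightarrow> 'b::comm_semiring_1"
  shows "(\<Prod>i\<in>A. Poly_Mapping.single (e i) (x i)) =
    Poly_Mapping.single (\<Sum>i\<in>A. e i) (\<Prod>i\<in>A. x i)"
  by (induction A rule: infinite_finite_induct) (auto simp: mult_single)

lemma single_single_power:
  fixes x :: "'b::comm_semiring_1"
  shows "Poly_Mapping.single (Poly_Mapping.single i m) x ^ k =
    Poly_Mapping.single (Poly_Mapping.single i (k * m)) (x ^ k)"
  by (induction k) (auto simp: mult_single simp flip: single_add)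

lemma prod_monom:
  fixes x :: "'i \<Rightarrow> 'b::comm_semiring_1"
  shows "(\<Prod>i\<in>A. monom (x i) (e i)) = monom (\<Prod>i\<in>A. x i) (\<Sum>i\<in>A. e i)"
  by (induction A rule: infinite_finite_induct) (auto simp: mult_monom monom_0)

section \<open>Coefficients of products of powers of t - z_a\<close>

lemma linear_power_eq_sum_monom:
  "[:- z a, 1:] ^ n = (\<Sum>i\<le>n. monom (Poly_Mapping.single (Poly_Mapping.single a i)
     ((-1) ^ i * of_nat (n choose i)) :: 'p::prime_card fp_poly) (n - i))"
proof -
  have "[:- z a, 1:] = monom (- z a :: 'p fp_poly) 0 + monom 1 1"
    by (simp add: monom_0 monom_Suc)
  then have "[:- z a, 1:] ^ n = (\<Sum>i\<le>n. of_nat (n choose i) * monom (- z a :: 'p fp_poly) 0 ^ i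
      * monom 1 1 ^ (n - i))"
    by (simp only: binomial_ring)
  also have "\<dots> = (\<Sum>i\<le>n. monom (Poly_Mapping.single (Poly_Mapping.single a i)
     ((-1) ^ i * of_nat (n choose i)) :: 'p fp_poly) (n - i))"
  proof (intro sum.cong refl)
    fix i
    have "(- z a :: 'p fp_poly) ^ i = Poly_Mapping.single (Poly_Mapping.single a i) ((-1) ^ i)"
      by (simp add: z_def single_single_power flip: single_uminus)
    moreover have "of_nat k = monom (Poly_Mapping.single 0 (of_nat k) :: 'p fp_poly) 0" for k
      by (simp add: monom_0 of_nat_poly)
    ultimately show "of_nat (n choose i) * monom (- z a :: 'p fp_poly) 0 ^ i * monom 1 1 ^ (n - i)
      = monom (Poly_Mapping.single (Poly_Mapping.single a i)
     ((-1) ^ i * of_nat (n choose i))) (n - i)"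
      by (simp add: monom_power mult_monom mult_single mult.commute del: single_of_nat)
  qed
  finally show ?thesis .
qed

text \<open>Expand each factor by the binomial theorem and distribute: \<open>h a\<close> is the
  exponent of z_a picked from factor \<open>a\<close>, which leaves t to the power
  \<open>n a - h a\<close>.\<close>

lemma coeff_prod_linear_powers:
  assumes "finite A"
  shows "coeff (\<Prod>a\<in>A. [:- z a, 1:] ^ n a) k =
    (\<Sum>h\<in>PiE A (\<lambda>a. {..n a}). (Poly_Mapping.single (\<Sum>a\<in>A. Poly_Mapping.single a (h a))
       (\<Prod>a\<in>A. (-1) ^ h a * of_nat (n a choose h a)) :: 'p::prime_card fp_poly)
       when (\<Sum>a\<in>A. n a - h a) = k)"
  using assms
  by (simp add: linear_power_eq_sum_monom prod_sum_PiE prod_monom prod_single coeff_sum when_def)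

text \<open>Supplies the exponent vector of a monomial that occurs in a given coefficient of the
  product.\<close>

lemma exists_bounded_sum:
  fixes n :: "'a \<Rightarrow> nat"
  assumes "finite A" and "s \<le> sum n A"
  shows "\<exists>h \<in> PiE A (\<lambda>a. {..n a}). sum h A = s"
  using assms
proof (induction A arbitrary: s)
  case (insert x A)
  \<comment> \<open>Greedy choice: \<open>x\<close> takes as much of \<open>s\<close> as its bound
    allows, and the rest still fits into \<open>A\<close>.\<close>
  have "s - min s (n x) \<le> sum n A"
    using insert by auto
  from insert.IH[OF this] obtain h where h: "h \<in> PiE A (\<lambda>a. {..n a})" "sum h A = s - min s (n x)"
    by blast
  have "sum (h(x := min s (n x))) A = sum h A"
    using insert.hyps(2) by (intro sum.cong) auto
  then have "sum (h(x := min s (n x))) (insert x A) = s"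
    using insert.hyps h(2) by simp
  moreover have "h(x := min s (n x)) \<in> PiE (insert x A) (\<lambda>a. {..n a})"
    using h(1) by (intro PiE_fun_upd) auto
  ultimately show ?case by blast
qed simp

text \<open>Both facts are read off the expansion. The second is homogeneity, written additively to
  avoid truncated subtraction.\<close>

lemma keys_coeff_prod_linear_powers:
  assumes "finite A"
    and "e \<in> keys (coeff (\<Prod>a\<in>A. [:- z a, 1:] ^ n a) k :: 'p::prime_card fp_poly)"
  shows "lookup e i \<le> (if i \<in> A then n i else 0)" and "(\<Sum>a\<in>A. lookup e a) + k = sum n A"
proof -
  from assms(2) obtain h where h: "h \<in> PiE A (\<lambda>a. {..n a})" "(\<Sum>a\<in>A. n a - h a) = k"
    "e = (\<Sum>a\<in>A. Poly_Mapping.single a (h a))"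
    unfolding coeff_prod_linear_powers[OF assms(1)]
    by (auto dest!: subsetD[OF keys_sum] simp: when_def split: if_splits)
  have e: "lookup e i = (if i \<in> A then h i else 0)" for i
    using assms(1) by (simp add: h(3) lookup_sum_single)
  show "lookup e i \<le> (if i \<in> A then n i else 0)"
    using h(1) by (auto simp: e)
  have "(\<Sum>a\<in>A. lookup e a) + k = (\<Sum>a\<in>A. h a + (n a - h a))"
    by (simp add: e h(2) sum.distrib)
  also have "\<dots> = sum n A"
    using h(1) by (intro sum.cong) (auto simp: PiE_iff)
  finally show "(\<Sum>a\<in>A. lookup e a) + k = sum n A" .
qed

text \<open>The binomial coefficient divides \<open>fact n\<close>, which is prime to p for n below
  p.\<close>

lemma of_nat_choose_mod_ring_neq_0:
  assumes "n < CARD('p::prime_card)" and "i \<le> n"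
  shows "of_nat (n choose i) \<noteq> (0 :: 'p mod_ring)"
proof
  assume "of_nat (n choose i) = (0 :: 'p mod_ring)"
  then have "CARD('p) dvd n choose i"
    by (simp add: of_nat_0_mod_ring_dvd)
  also have "\<dots> dvd fact n"
    using binomial_fact_lemma[OF assms(2)] by (metis dvd_triv_right)
  finally show False
    using assms(1) prime_card[where 'a = 'p] by (simp add: prime_dvd_fact_iff)
qed

lemma coeff_prod_linear_powers_neq_0:
  assumes A: "finite A" and n: "\<And>a. a \<in> A \<Longrightarrow> n a < CARD('p)" and k: "k \<le> sum n A"
  shows "coeff (\<Prod>a\<in>A. [:- z a, 1:] ^ n a) k \<noteq> (0 :: 'p::prime_card fp_poly)"
proof -
  obtain h where h: "h \<in> PiE A (\<lambda>a. {..n a})" "sum h A = sum n A - k"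
    using exists_bounded_sum[OF A, of "sum n A - k" n] by auto
  let ?E = "\<lambda>h. \<Sum>a\<in>A. Poly_Mapping.single a (h a)"
  \<comment> \<open>Different choices give different monomials, so no cancellation can occur in the
    expansion.\<close>
  have inj: "h' = h" if "h' \<in> PiE A (\<lambda>a. {..n a})" "?E h' = ?E h" for h'
    using that(1) h(1)
  proof (rule PiE_ext)
    fix i assume "i \<in> A"
    then show "h' i = h i"
      using lookup_sum_single[OF A, of h' i] lookup_sum_single[OF A, of h i] that(2) by simp
  qed
  have "(\<Sum>a\<in>A. n a - h a) = sum n A - sum h A"
    using h(1) by (intro sum_subtractf_nat) auto
  then have "(\<Sum>a\<in>A. n a - h a) = k"
    using h(2) k by simp
  then have "lookup (coeff (\<Prod>a\<in>A. [:- z a, 1:] ^ n a) k :: 'p fp_poly) (?E h) =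
    (\<Sum>h'\<in>PiE A (\<lambda>a. {..n a}). if h' = h then \<Prod>a\<in>A. (-1) ^ h a * of_nat (n a choose h a) else 0)"
    unfolding coeff_prod_linear_powers[OF A] lookup_sum
    by (intro sum.cong refl) (auto simp: when_def lookup_single dest: inj)
  also have "\<dots> = (\<Prod>a\<in>A. (-1) ^ h a * of_nat (n a choose h a))"
    using A h(1) by (simp add: finite_PiE)
  also have "\<dots> \<noteq> 0"
    using A h(1) n by (auto simp: of_nat_choose_mod_ring_neq_0 PiE_iff)
  finally show ?thesis by auto
qed

section \<open>The solutions I^m and the ring F_p[z^p]\<close>

lemma P_poly_eq_prod:
  assumes "CARD('p) \<ge> 3" and j: "j \<in> {1..2 * g + 1}"
  shows "P_poly g j = (\<Prod>a = 1..2 * g + 1. [:- z a, 1 :: 'p::prime_card fp_poly:] ^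
    ((CARD('p) - 1) div 2 - (if a = j then 1 else 0)))"
proof -
  define q where "q = (CARD('p) - 1) div 2"
  define f where "f a = [:- z a, 1 :: 'p fp_poly:]" for a
  let ?A = "{1..2 * g + 1}"
  \<comment> \<open>Positivity of \<open>q\<close> makes the truncated exponent \<open>q - 1\<close>
    exact, so that multiplying by \<open>f j\<close> restores the master polynomial.\<close>
  have q: "q = Suc (q - 1)"
    using assms(1) by (simp add: q_def)
  have "(\<Prod>a\<in>?A. f a ^ (q - (if a = j then 1 else 0))) = f j ^ (q - 1) * (\<Prod>a\<in>?A - {j}. f a ^ q)"
    unfolding prod.remove[OF finite_atLeastAtMost j] by (auto intro: prod.cong)
  then have "f j * (\<Prod>a\<in>?A. f a ^ (q - (if a = j then 1 else 0))) =
      f j ^ Suc (q - 1) * (\<Prod>a\<in>?A - {j}. f a ^ q)"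
    by (simp only: power_Suc mult.assoc)
  also have "\<dots> = (\<Prod>a\<in>?A. f a ^ q)"
    unfolding prod.remove[OF finite_atLeastAtMost j] q[symmetric] by (rule refl)
  finally show ?thesis
    using P_poly_unique[OF assms] by (simp only: f_def q_def master_poly_def)
qed

text \<open>The polynomials all of whose exponents are divisible by p contain the generators and are
  closed under the algebra operations.\<close>

lemma dvd_lookup_keys_Fp_zp:
  assumes "c \<in> (Fp_zp g :: 'p::prime_card fp_poly set)" and "e \<in> keys c"
  shows "CARD('p) dvd lookup e i"
  using assms unfolding Fp_zp_def
proof (induction c arbitrary: e rule: subalgebra_gen.induct)
  case (const a)
  then show ?case by (simp add: const_def split: if_splits)
next
  case (gen x)
  then show ?case by (auto simp: z_def single_single_power lookup_single when_def)
next
  case (add x y)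
  then show ?case using keys_add[of x y] by blast
next
  case (mult x y)
  then show ?case using keys_mult[of x y] by (fastforce simp: lookup_add)
qed

theorem theorem3p1:
  fixes g :: nat
  assumes "g > 0" and "CARD('p::prime_card) \<ge> 2 * g + 1"
  shows "\<forall>c :: nat \<Rightarrow> 'p fp_poly.
    (\<forall>m \<in> {0..<g}. c m \<in> Fp_zp g) \<longrightarrow>
    (\<forall>j \<in> {1..2 * g + 1}. (\<Sum>m = 0..<g. c m * I_sol g m j) = 0) \<longrightarrow>
    (\<forall>m \<in> {0..<g}. c m = 0)"
proof (intro allI impI ballI)
  fix c :: "nat \<Rightarrow> 'p fp_poly" and m
  assume c: "\<forall>m \<in> {0..<g}. c m \<in> Fp_zp g"
    and rel: "\<forall>j \<in> {1..2 * g + 1}. (\<Sum>m = 0..<g. c m * I_sol g m j) = 0"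
    and m: "m \<in> {0..<g}"
  let ?p = "CARD('p)" and ?A = "{1..2 * g + 1}"
  define q where "q = (?p - 1) div 2"
  define n where "n a = q - (if a = 1 then 1 else 0)" for a :: nat
  have p3: "?p \<ge> 3"
    using assms by simp
  have "odd ?p"
    using p3 prime_card[where 'a = 'p] by (simp add: prime_odd_nat)
  then have p: "?p = 2 * q + 1" and qg: "q \<ge> g" and nq: "n a < ?p" for a
    using assms(2) by (auto simp: q_def n_def elim!: oddE)
  have "sum n ?A = q - 1 + 2 * g * q"
    by (subst sum.atLeast_Suc_atMost) (simp_all add: n_def)
  \<comment> \<open>In this form, \<open>q \<ge> g\<close> shows that even the largest index, g p -
    1 for m = 0, is within the degree in t.\<close>
  then have sum_n: "sum n ?A = g * ?p + (q - g) - 1"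
    using qg assms(1) by (simp add: p algebra_simps)
  have I: "I_sol g m' 1 = coeff (\<Prod>a\<in>?A. [:- z a, 1 :: 'p fp_poly:] ^ n a) ((g - m') * ?p - 1)" for m'
    by (simp add: I_sol_def P_coeff_def P_poly_eq_prod p3 n_def q_def)
  have "(g - m) * ?p \<le> g * ?p"
    by (intro mult_right_mono) auto
  then have "(g - m) * ?p - 1 \<le> sum n ?A"
    unfolding sum_n by linarith
  then have "(I_sol g m 1 :: 'p fp_poly) \<noteq> 0"
    unfolding I by (intro coeff_prod_linear_powers_neq_0 nq finite_atLeastAtMost)
  then obtain e where e: "e \<in> keys (I_sol g m 1 :: 'p fp_poly)"
    by (metis keys_eq_empty ex_in_conv)
  note keys_I = keys_coeff_prod_linear_powers[where A = ?A and n = n and 'p = 'p,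
    OF finite_atLeastAtMost, of _ "(g - _) * ?p - 1", folded I]
  have small: "lookup e' i < ?p" if "e' \<in> keys (I_sol g m' 1 :: 'p fp_poly)" for e' m' i
    using keys_I(1)[OF that, of i] nq[of i] p3 by (auto split: if_splits)
  \<comment> \<open>By homogeneity, the degree of a shared monomial \<open>e\<close> would determine
    the index of the coefficient of t, hence \<open>m' = m\<close>.\<close>
  have other: "lookup (I_sol g m' 1 :: 'p fp_poly) e = 0" if "m' \<in> {0..<g}" "m' \<noteq> m" for m'
  proof (rule ccontr)
    assume "lookup (I_sol g m' 1 :: 'p fp_poly) e \<noteq> 0"
    then have "(g - m') * ?p - 1 = (g - m) * ?p - 1"
      using keys_I(2)[OF e] keys_I(2)[of e m'] by (simp add: in_keys_iff)
    \<comment> \<open>Truncated subtraction of 1 can be cancelled only between positive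
      numbers.\<close>
    moreover have "(g - m') * ?p > 0" "(g - m) * ?p > 0"
      using that m by auto
    ultimately have "(g - m') * ?p = (g - m) * ?p"
      by linarith
    then show False
      using that m by auto
  qed
  show "c m = 0"
  proof (rule ccontr)
    assume "c m \<noteq> 0"
    then obtain a where a: "a \<in> keys (c m)"
      by (metis keys_eq_empty ex_in_conv)
    have split: "lookup (c m' * I_sol g m' 1) (a + e) = lookup (c m') a * lookup (I_sol g m' 1) e"
      if m': "m' \<in> {0..<g}" for m'
    proof (rule lookup_mult_unique_split)
      fix l r
      assume l: "l \<in> keys (c m')" and r: "r \<in> keys (I_sol g m' 1 :: 'p fp_poly)" and eq: "l + r = a + e"
      \<comment> \<open>Uniqueness of remainders modulo p in each coordinate: \<open>l\<close> and
        \<open>a\<close> contribute multiples of p, while \<open>r\<close> and \<open>e\<close> have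
        entries below p.\<close>
      have "lookup r i = lookup e i" for i
      proof -
        have "lookup l i + lookup r i = lookup a i + lookup e i"
          using eq by (metis lookup_add)
        moreover have "?p dvd lookup l i" "?p dvd lookup a i"
          using dvd_lookup_keys_Fp_zp c m m' l a by blast+
        ultimately have "lookup r i mod ?p = lookup e i mod ?p"
          by (metis mod_add_left_eq dvd_imp_mod_0 add_0)
        then show ?thesis
          using small[OF r, of i] small[OF e, of i] by simp
      qed
      then have "r = e" by (rule poly_mapping_eqI)
      with eq show "l = a \<and> r = e" by simp
    qed
    \<comment> \<open>At the monomial \<open>a + e\<close>, coordinate 1 of the relation retains
      only the term \<open>m' = m\<close>, a product of two nonzero field elements.\<close>
    have "0 = lookup (\<Sum>m' = 0..<g. c m' * I_sol g m' 1) (a + e)"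
      using rel by simp
    also have "\<dots> = (\<Sum>m' = 0..<g. lookup (c m') a * lookup (I_sol g m' 1) e)"
      unfolding lookup_sum by (intro sum.cong refl split)
    also have "\<dots> = (\<Sum>m' \<in> {m}. lookup (c m') a * lookup (I_sol g m' 1) e)"
      using m other by (intro sum.mono_neutral_right) auto
    also have "\<dots> \<noteq> 0"
      using a e by (simp add: in_keys_iff)
    finally show False by simp
  qed
qed

end
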